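(* Let $(\mathcal{F},\psi,\mathcal{J})$ be a standardized two-Krein space, $t\in\mathcal{F}$, and $f:[a,b]\to\mathcal{F}$ a function strongly of bounded $t$-variation over $[a,b]$. If $V_{a}^{b}(f,\mathcal{F},t)_{\mathcal{J}}=0$, then for all $x\in[a,b]$, $$\mathcal{N}_{\mathcal{J}}(f(x),t)=\mathcal{N}_{\mathcal{J}}(f(a),t)=\mathcal{N}_{\mathcal{J}}(f(b),t).$$
   Context: A Krein space is a pair $(\mathcal{F},[\cdot,\cdot])$ where $\mathcal{F}$ is a complex vector space and $[\cdot,\cdot]$ is an indefinite inner product (a Hermitian sesquilinear form, linear in the first variable) admitting a direct sum decomposition $\mathcal{F}=\mathcal{F}^{+}\dot{+}\mathcal{F}^{-}$ into mutually $[\cdot,\cdot]$-orthogonal subspaces (a fundamental decomposition) such that $(\mathcal{F}^{+},[\cdot,\cdot])$ and $(\mathcal{F}^{-},-[\cdot,\cdot])$ are Hilbert spaces. Each $x\in\mathcal{F}$ is written $x=x^{+}+x^{-}$ with $x^{\pm}\in\mathcal{F}^{\pm}$; the fundamental symmetry is $\mathcal{J}x=x^{+}-x^{-}$; $\|x^{+}\|_{+}=\sqrt{[x^{+},x^{+}]}$, $\|x^{-}\|_{-}=\sqrt{-[x^{-},x^{-}]}$. A standardized two-Krein space $(\mathcal{F},\psi,\mathcal{J})$ is such a Krein space, of dimension at least $2$, equipped with $\psi(x,y,z)=[x^{+},y^{+}]\|z^{+}\|_{+}^{2}+[x^{-},y^{-}]\|z^{-}\|_{-}^{2}$. Its $\mathcal{J}$-two-norm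 is $\mathcal{N}_{\mathcal{J}}(x,y)=\sqrt{\psi(\mathcal{J}x,x,y)}$. Let $\mathcal{P}[a,b]$ be the set of finite partitions $a=x_0<x_1<\dots<x_n=b$ of the closed interval $[a,b]$. For $f:[a,b]\to\mathcal{F}$ the $t$-variation is $V_{a}^{b}(f,\mathcal{F},t)_{\mathcal{J}}=\sup_{P\in\mathcal{P}[a,b]}\sum_{i=1}^{n}\mathcal{N}_{\mathcal{J}}(f(x_i)-f(x_{i-1}),t)$, and $f$ is strongly of bounded $t$-variation if this is finite. *)

theory Defs
  imports "HOL-Analysis.Analysis"
begin

locale hermitian_form = vector_space smul
  for smul :: "complex \<Rightarrow> 'a::ab_group_add \<Rightarrow> 'a" +
  fixes ip :: "'a \<Rightarrow> 'a \<Rightarrow> complex"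
  assumes ip_add_left: "ip (x + y) z = ip x z + ip y z"
    and ip_scale_left: "ip (smul c x) y = c * ip x y"
    and ip_hermitian: "ip y x = cnj (ip x y)"

definition form_norm :: "('a \<Rightarrow> 'a \<Rightarrow> complex) \<Rightarrow> 'a \<Rightarrow> real" where
  "form_norm ip x = sqrt (Re (ip x x))"

text \<open>Hermitian symmetry makes \<open>ip x x\<close> real, so positivity of its real part is
  positive definiteness.\<close>

definition hilbert_subspace ::
  "(complex \<Rightarrow> 'a::ab_group_add \<Rightarrow> 'a) \<Rightarrow> ('a \<Rightarrow> 'a \<Rightarrow> complex) \<Rightarrow> 'a set \<Rightarrow> bool" where
  "hilbert_subspace smul ip S \<longleftrightarrow>
     hermitian_form smul ip \<and>
     module.subspace smul S \<and>
     (\<forall>x\<in>S. x \<noteq> 0 \<longrightarrow> 0 < Re (ip x x)) \<and>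
     (\<forall>\<sigma>. (\<forall>n. \<sigma> n \<in> S) \<and>
          (\<forall>e>0. \<exists>N. \<forall>m\<ge>N. \<forall>n\<ge>N. form_norm ip (\<sigma> m - \<sigma> n) < e) \<longrightarrow>
          (\<exists>l\<in>S. (\<lambda>n::nat. form_norm ip (\<sigma> n - l)) \<longlonglongrightarrow> 0))"

text \<open>The space is the whole type \<open>'a\<close>. ``Indefinite'' is read as ``not assumed
  definite'': either summand may be \<open>{0}\<close>.\<close>

locale krein_space = hermitian_form smul ip
  for smul :: "complex \<Rightarrow> 'a::ab_group_add \<Rightarrow> 'a"
    and ip :: "'a \<Rightarrow> 'a \<Rightarrow> complex" +
  fixes Fp Fm :: "'a set"
  assumes decomposition: "\<exists>u\<in>Fp. \<exists>v\<in>Fm. x = u + v"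
    and direct: "Fp \<inter> Fm = {0}"
    and orthogonal: "u \<in> Fp \<Longrightarrow> v \<in> Fm \<Longrightarrow> ip u v = 0"
    and hilbert_pos: "hilbert_subspace smul ip Fp"
    and hilbert_neg: "hilbert_subspace smul (\<lambda>x y. - ip x y) Fm"

text \<open>\<open>component A B x\<close> is the \<open>A\<close>-part of \<open>x\<close> in the direct sum of \<open>A\<close> and \<open>B\<close>; so
  \<open>component Fp Fm x\<close> is $x^+$ and \<open>component Fm Fp x\<close> is $x^-$.\<close>

definition component :: "'a::ab_group_add set \<Rightarrow> 'a set \<Rightarrow> 'a \<Rightarrow> 'a" where
  "component A B x = (THE u. u \<in> A \<and> (\<exists>v\<in>B. x = u + v))"

locale standardized_two_krein_space = krein_space smul ip Fp Fm
  for smul :: "complex \<Rightarrow> 'a::ab_group_add \<Rightarrow> 'a"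
    and ip :: "'a \<Rightarrow> 'a \<Rightarrow> complex"
    and Fp Fm :: "'a set" +
  fixes \<psi> :: "'a \<Rightarrow> 'a \<Rightarrow> 'a \<Rightarrow> complex"
    and J :: "'a \<Rightarrow> 'a"
  assumes dim_ge_2: "\<exists>x y. x \<noteq> y \<and> independent {x, y}"
    and J_eq: "J x = component Fp Fm x - component Fm Fp x"
    and \<psi>_eq: "\<psi> x y z =
      ip (component Fp Fm x) (component Fp Fm y)
        * of_real ((form_norm ip (component Fp Fm z))\<^sup>2) +
      ip (component Fm Fp x) (component Fm Fp y)
        * of_real ((form_norm (\<lambda>u v. - ip u v) (component Fm Fp z))\<^sup>2)"

text \<open>In a standardized two-Krein space \<open>\<psi> (J x) x y\<close> is real and nonnegative, so
  taking the real part loses nothing.\<close>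

definition two_norm ::
  "('a \<Rightarrow> 'a \<Rightarrow> 'a \<Rightarrow> complex) \<Rightarrow> ('a \<Rightarrow> 'a) \<Rightarrow> 'a \<Rightarrow> 'a \<Rightarrow> real" where
  "two_norm \<psi> J x y = sqrt (Re (\<psi> (J x) x y))"

text \<open>Finite partitions are represented by the strictly increasing list of their points.
  For \<open>a = b\<close> the only one is \<open>[a]\<close>.\<close>

definition partitions :: "real \<Rightarrow> real \<Rightarrow> real list set" where
  "partitions a b = {xs. xs \<noteq> [] \<and> hd xs = a \<and> last xs = b \<and> sorted_wrt (<) xs}"

definition t_variation ::
  "('a::ab_group_add \<Rightarrow> 'a \<Rightarrow> 'a \<Rightarrow> complex) \<Rightarrow> ('a \<Rightarrow> 'a) \<Rightarrow>
    real \<Rightarrow> real \<Rightarrow> (real \<Rightarrow> 'a) \<Rightarrow> 'a \<Rightarrow> ereal" where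
  "t_variation \<psi> J a b f t =
     (SUP xs\<in>partitions a b.
        ereal (\<Sum>i=1..<length xs. two_norm \<psi> J (f (xs ! i) - f (xs ! (i - 1))) t))"

definition strongly_bounded_t_variation ::
  "('a::ab_group_add \<Rightarrow> 'a \<Rightarrow> 'a \<Rightarrow> complex) \<Rightarrow> ('a \<Rightarrow> 'a) \<Rightarrow>
    real \<Rightarrow> real \<Rightarrow> (real \<Rightarrow> 'a) \<Rightarrow> 'a \<Rightarrow> bool" where
  "strongly_bounded_t_variation \<psi> J a b f t \<longleftrightarrow> t_variation \<psi> J a b f t < \<infinity>"

end

theory Submission
  imports Defs
begin

text \<open>
  Write \<open>\<parallel>t\<^sup>+\<parallel>\<close> and \<open>\<parallel>t\<^sup>-\<parallel>\<close> for the Hilbert norms of the two components of \<open>t\<close>. The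
  fundamental symmetry changes the sign of the negative component only, which turns the
  indefinite form into a positive one:
  \<open>\<N>(x, t)\<^sup>2 = [x\<^sup>+, x\<^sup>+] \<parallel>t\<^sup>+\<parallel>\<^sup>2 + (- [x\<^sup>-, x\<^sup>-]) \<parallel>t\<^sup>-\<parallel>\<^sup>2\<close>,
  a sum of two nonnegative terms (\<open>two_norm_eq\<close>).

  Zero variation forces \<open>\<N>(f x - f a, t) = 0\<close> for every \<open>x\<close>, because that number is a
  summand of the sum of nonnegative terms belonging to a partition whose first step is
  from \<open>a\<close> to \<open>x\<close>, unless \<open>x = a\<close>, where it is trivially zero
  (\<open>zero_variation_imp_two_norm_diff_zero\<close>). It remains to see that
  \<open>\<N>(x - y, t) = 0\<close> implies \<open>\<N>(x, t) = \<N>(y, t)\<close>. The reverse triangle inequality would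
  give this, but the formula does so directly: if the sum vanishes, then in each of the
  two summands either the weight coming from \<open>t\<close> is zero or, by definiteness, the
  components of \<open>x\<close> and \<open>y\<close> coincide; so corresponding summands of
  \<open>\<N>(x, t)\<^sup>2\<close> and \<open>\<N>(y, t)\<^sup>2\<close> agree (\<open>two_norm_eq_if_diff_zero\<close>).
\<close>

lemma (in module) component_add_eq:
  assumes A: "subspace A" and B: "subspace B" and AB: "A \<inter> B = {0}"
    and u: "u \<in> A" and v: "v \<in> B"
  shows "component A B (u + v) = u"
  unfolding component_def
proof (rule the_equality)
  show "u \<in> A \<and> (\<exists>w\<in>B. u + v = u + w)"
    using u v by blast
next
  fix u'
  assume "u' \<in> A \<and> (\<exists>w\<in>B. u + v = u' + w)"
  then obtain w where u': "u' \<in> A" and w: "w \<in> B" and eq: "u + v = u' + w"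
    by blast
  have "u' - u = v - w"
    using eq by (simp add: algebra_simps)
  moreover have "u' - u \<in> A" "v - w \<in> B"
    using A B u u' v w by (simp_all add: subspace_diff)
  ultimately have "u' - u \<in> A \<inter> B"
    by simp
  then show "u' = u"
    using AB by simp
qed

context krein_space
begin

abbreviation pos_part :: "'a \<Rightarrow> 'a" where
  "pos_part \<equiv> component Fp Fm"

abbreviation neg_part :: "'a \<Rightarrow> 'a" where
  "neg_part \<equiv> component Fm Fp"

lemma subspace_Fp: "subspace Fp" and subspace_Fm: "subspace Fm"
  using hilbert_pos hilbert_neg by (simp_all add: hilbert_subspace_def)

lemma parts_add_eq:
  assumes "u \<in> Fp" "v \<in> Fm"
  shows "pos_part (u + v) = u" "neg_part (u + v) = v"
  using component_add_eq[OF subspace_Fp subspace_Fm direct assms]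
    component_add_eq[OF subspace_Fm subspace_Fp _ assms(2,1)] direct
  by (simp_all add: Int_commute add.commute)

lemma parts_mem: "pos_part x \<in> Fp" "neg_part x \<in> Fm"
  and parts_sum: "pos_part x + neg_part x = x"
proof -
  obtain u v where "u \<in> Fp" "v \<in> Fm" "x = u + v"
    using decomposition[of x] by blast
  then show "pos_part x \<in> Fp" "neg_part x \<in> Fm" "pos_part x + neg_part x = x"
    by (simp_all add: parts_add_eq)
qed

lemma parts_diff:
  "pos_part (x - y) = pos_part x - pos_part y"
  "neg_part (x - y) = neg_part x - neg_part y"
proof -
  have "x - y = (pos_part x - pos_part y) + (neg_part x - neg_part y)"
    by (simp add: parts_sum flip: add_diff_add)
  then show "pos_part (x - y) = pos_part x - pos_part y"
    and "neg_part (x - y) = neg_part x - neg_part y"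
    using parts_add_eq[of "pos_part x - pos_part y" "neg_part x - neg_part y"]
    by (simp_all add: subspace_diff subspace_Fp subspace_Fm parts_mem)
qed

lemma parts_reflection:
  "pos_part (pos_part x - neg_part x) = pos_part x"
  "neg_part (pos_part x - neg_part x) = - neg_part x"
  using parts_add_eq[of "pos_part x" "- neg_part x"]
  by (simp_all add: subspace_neg subspace_Fm parts_mem)

lemma ip_zero_left: "ip 0 y = 0"
  using ip_add_left[of 0 0 y] by simp

lemma ip_minus_left: "ip (- x) y = - ip x y"
  using ip_add_left[of "- x" x y] by (simp add: ip_zero_left eq_neg_iff_add_eq_0)

lemma ip_pos_definite:
  assumes "u \<in> Fp"
  shows "0 \<le> Re (ip u u)" "Re (ip u u) = 0 \<longleftrightarrow> u = 0"
proof -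
  have "0 < Re (ip u u)" if "u \<noteq> 0"
    using hilbert_pos assms that unfolding hilbert_subspace_def by blast
  then show "0 \<le> Re (ip u u)" "Re (ip u u) = 0 \<longleftrightarrow> u = 0"
    by (cases "u = 0"; force simp: ip_zero_left)+
qed

lemma ip_neg_definite:
  assumes "v \<in> Fm"
  shows "0 \<le> - Re (ip v v)" "Re (ip v v) = 0 \<longleftrightarrow> v = 0"
proof -
  have "Re (ip v v) < 0" if "v \<noteq> 0"
    using hilbert_neg assms that unfolding hilbert_subspace_def by fastforce
  then show "0 \<le> - Re (ip v v)" "Re (ip v v) = 0 \<longleftrightarrow> v = 0"
    by (cases "v = 0"; force simp: ip_zero_left)+
qed

end

context standardized_two_krein_space
begin

text \<open>Reflecting only the first argument of the form makes the contribution of \<open>x\<^sup>-\<close>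
  equal to \<open>- [x\<^sup>-, x\<^sup>-]\<close>, which is nonnegative.\<close>

lemma two_norm_eq:
  "two_norm \<psi> J x t = sqrt
     (Re (ip (pos_part x) (pos_part x)) * (form_norm ip (pos_part t))\<^sup>2 +
      - Re (ip (neg_part x) (neg_part x)) * (form_norm (\<lambda>u v. - ip u v) (neg_part t))\<^sup>2)"
  unfolding two_norm_def \<psi>_eq J_eq parts_reflection ip_minus_left
  by (simp flip: of_real_power)

lemma two_norm_nonneg: "0 \<le> two_norm \<psi> J x t"
  unfolding two_norm_eq
  by (intro real_sqrt_ge_zero add_nonneg_nonneg mult_nonneg_nonneg zero_le_power2
      ip_pos_definite(1) ip_neg_definite(1) parts_mem)

text \<open>Both summands under the root are nonnegative, so they vanish separately, and each
  form is definite on its own summand of the decomposition.\<close>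

lemma two_norm_eq_0_iff:
  "two_norm \<psi> J x t = 0 \<longleftrightarrow>
     (pos_part x = 0 \<or> form_norm ip (pos_part t) = 0) \<and>
     (neg_part x = 0 \<or> form_norm (\<lambda>u v. - ip u v) (neg_part t) = 0)"
proof -
  have "0 \<le> Re (ip (pos_part x) (pos_part x)) * (form_norm ip (pos_part t))\<^sup>2"
    by (intro mult_nonneg_nonneg zero_le_power2 ip_pos_definite(1) parts_mem)
  moreover have "0 \<le> - Re (ip (neg_part x) (neg_part x)) *
      (form_norm (\<lambda>u v. - ip u v) (neg_part t))\<^sup>2"
    by (intro mult_nonneg_nonneg zero_le_power2 ip_neg_definite(1) parts_mem)
  ultimately show ?thesis
    unfolding two_norm_eq real_sqrt_eq_0_iff
    by (subst add_nonneg_eq_0_iff)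
      (simp_all add: ip_pos_definite(2) ip_neg_definite(2) parts_mem)
qed

lemma two_norm_zero: "two_norm \<psi> J 0 t = 0"
  using parts_diff[of 0 0] by (simp add: two_norm_eq_0_iff)

lemma two_norm_eq_if_diff_zero:
  assumes "two_norm \<psi> J (x - y) t = 0"
  shows "two_norm \<psi> J x t = two_norm \<psi> J y t"
  using assms unfolding two_norm_eq_0_iff parts_diff
  by (auto simp: two_norm_eq)

lemma zero_variation_imp_increment_zero:
  assumes var: "t_variation \<psi> J a b f t = 0" and xs: "xs \<in> partitions a b"
    and i: "i \<in> {1..<length xs}"
  shows "two_norm \<psi> J (f (xs ! i) - f (xs ! (i - 1))) t = 0"
proof -
  let ?s = "\<lambda>i. two_norm \<psi> J (f (xs ! i) - f (xs ! (i - 1))) t"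
  have "ereal (\<Sum>i=1..<length xs. ?s i) \<le> 0"
    unfolding var[symmetric] t_variation_def using xs by (rule SUP_upper)
  moreover have "0 \<le> (\<Sum>i=1..<length xs. ?s i)"
    by (intro sum_nonneg two_norm_nonneg)
  ultimately have "(\<Sum>i=1..<length xs. ?s i) = 0"
    by simp
  then show ?thesis
    using i sum_nonneg_eq_0_iff[of "{1..<length xs}" ?s] two_norm_nonneg by simp
qed

lemma zero_variation_imp_two_norm_diff_zero:
  assumes var: "t_variation \<psi> J a b f t = 0" and x: "x \<in> {a..b}"
  shows "two_norm \<psi> J (f x - f a) t = 0"
proof -
  \<comment> \<open>The points of a partition are distinct, so the endpoints need their own lists.\<close>
  consider "x = a" | "a < x" "x = b" | "a < x" "x < b"
    using x by fastforce
  then show ?thesis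
  proof cases
    case 1
    then show ?thesis
      by (simp add: two_norm_zero)
  next
    case 2
    then have "[a, x] \<in> partitions a b"
      by (simp add: partitions_def)
    from zero_variation_imp_increment_zero[OF var this, of 1] show ?thesis
      by simp
  next
    case 3
    then have "[a, x, b] \<in> partitions a b"
      by (simp add: partitions_def)
    from zero_variation_imp_increment_zero[OF var this, of 1] show ?thesis
      by simp
  qed
qed

end

theorem proposition5p2:
  fixes smul :: "complex \<Rightarrow> 'a::ab_group_add \<Rightarrow> 'a"
    and ip :: "'a \<Rightarrow> 'a \<Rightarrow> complex"
    and Fp Fm :: "'a set"
    and \<psi> :: "'a \<Rightarrow> 'a \<Rightarrow> 'a \<Rightarrow> complex"
    and J :: "'a \<Rightarrow> 'a"
    and a b :: real and f :: "real \<Rightarrow> 'a" and t :: 'a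
  assumes "standardized_two_krein_space smul ip Fp Fm \<psi> J"
    and "a \<le> b"
    and "strongly_bounded_t_variation \<psi> J a b f t"
    and "t_variation \<psi> J a b f t = 0"
  shows "\<forall>x\<in>{a..b}. two_norm \<psi> J (f x) t = two_norm \<psi> J (f a) t
                    \<and> two_norm \<psi> J (f a) t = two_norm \<psi> J (f b) t"
proof -
  interpret standardized_two_krein_space smul ip Fp Fm \<psi> J
    by fact
  have "two_norm \<psi> J (f x) t = two_norm \<psi> J (f a) t" if "x \<in> {a..b}" for x
    using zero_variation_imp_two_norm_diff_zero[OF assms(4) that]
    by (rule two_norm_eq_if_diff_zero)
  moreover have "b \<in> {a..b}"
    using \<open>a \<le> b\<close> by simp
  ultimately show ?thesis
    by metis
qed

end
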